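(* Let $N\ge 1$, $p\ge 0$ and $k$ be integers with $p<k\leqslant N$, and let $x^k\in L_k$. If a monotone Boolean function $f:\{0,1\}^N\to\{0,1\}$ is ideal with respect to $x^k$, then $$2^N\hat f(i)=\binom{N-1}{p}-\binom{k-1}{p},\qquad 2^N\hat f(j)=\binom{N-1}{p}+\sum_{l=p+1}^{k}\binom{k}{l},$$ for every inlier $i$ (i.e. $i\in\{1,\dots,N\}$ with $x^k_i=1$) and every outlier $j$ (i.e. $j\in\{1,\dots,N\}$ with $x^k_j=0$).
   Context: $\{0,1\}^N$ carries the componentwise partial order; $f:\{0,1\}^N\to\{0,1\}$ is monotone if $x\le y$ implies $f(x)\le f(y)$. $\|x\|_1$ is the number of ones in $x$; $L_k=\{x\in\{0,1\}^N:\|x\|_1=k\}$ and $L_{\leqslant k}=\{x:\|x\|_1\leqslant k\}$. $\Delta(x,y)=\#\{i:x_i\ne y_i\}$ is the Hamming distance. For $x^k\in L_k$ with $k>p$, the Boolean sub-cube determined by $x^k$ is $B_{x^k}=\{x\in\{0,1\}^N:\Delta(x,x^k)=i,\ x\in L_{k-i},\ 0\leqslant i\leqslant k-p-1\}$, i.e. the set of all $x\le x^k$ with $p+1\le\|x\|_1\le k$. A monotone Boolean function $f$ is called ideal with respect to $x^k\in L_k$ ($p<k\le N$) if $f(x)=0$ for all $x\in B_{x^k}\cup L_{\leqslant p}$ and $f(x)=1$ for all other $x$. Influence: for $i\in\{1,\dots,N\}$, $\hat f(i)=2^{-N}\sum_{x\in\{0,1\}^N}f(x)(-1)^{1+x_i}$.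 For monotone $f$, $2^N\hat f(i)$ is the number of $x\in\{0,1\}^N$ with $x_i=0$, $f(x)=0$ and $f(x+e_i)=1$, where $x+e_i$ is $x$ with the $i$-th bit changed to $1$. Binomial coefficients $\binom{a}{b}$ are $0$ if $b>a$. *)

theory Defs
  imports Complex_Main "HOL-Library.Cardinality"
begin

(* The cube {0,1}^N is the type 'n => bool with N = CARD('n): the coordinates are the
   elements of 'n, and bits 0 and 1 are False and True. The order on this type is the
   componentwise one, so a monotone Boolean function is f :: ('n => bool) => bool with mono f. *)

type_synonym 'n cube = "'n \<Rightarrow> bool"

definition ones :: "('n::finite) cube \<Rightarrow> nat" where
  "ones x = card {i. x i}"

definition layer :: "nat \<Rightarrow> ('n::finite) cube set" where
  "layer k = {x. ones x = k}"

definition layers_upto :: "nat \<Rightarrow> ('n::finite) cube set" where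
  "layers_upto k = {x. ones x \<le> k}"

definition hamming :: "('n::finite) cube \<Rightarrow> 'n cube \<Rightarrow> nat" where
  "hamming x y = card {i. x i \<noteq> y i}"

(* Intended for p < k and xk in layer k, so neither natural-number subtraction truncates. *)
definition subcube :: "nat \<Rightarrow> nat \<Rightarrow> ('n::finite) cube \<Rightarrow> 'n cube set" where
  "subcube p k xk = {x. \<exists>i \<le> k - p - 1. hamming x xk = i \<and> x \<in> layer (k - i)}"

definition ideal_wrt :: "nat \<Rightarrow> nat \<Rightarrow> ('n::finite) cube \<Rightarrow> ('n cube \<Rightarrow> bool) \<Rightarrow> bool" where
  "ideal_wrt p k xk f \<longleftrightarrow>
     mono f \<and>
     (\<forall>x \<in> subcube p k xk \<union> layers_upto p. \<not> f x) \<and>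
     (\<forall>x. x \<notin> subcube p k xk \<union> layers_upto p \<longrightarrow> f x)"

definition influence :: "(('n::finite) cube \<Rightarrow> bool) \<Rightarrow> 'n \<Rightarrow> real" where
  "influence f i =
     1 / 2 ^ CARD('n) * (\<Sum>x\<in>UNIV. of_bool (f x) * (-1) ^ (1 + of_bool (x i)))"

end

theory Submission
  imports Defs
begin

text \<open>Identify a point of the cube with the set of its ones, and let \<open>K\<close> be the set of ones
  of \<open>xk\<close>. The signs cancel over the whole cube, so the influence at \<open>i\<close> is the sum of
  \<open>(-1)\<^bsup>[i \<in> A]\<^esup>\<close> over the zeros \<open>A\<close> of \<open>f\<close>, which are the \<open>A\<close> with \<open>|A| \<le> p\<close> and the
  \<open>A \<subseteq> K\<close> with \<open>|A| > p\<close>. Pairing \<open>A\<close> with \<open>A \<union> {i}\<close> leaves only the unpaired sets of size \<open>p\<close>.\<close>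

text \<open>The symmetric difference has size \<open>card K - card A + 2 * card (A - K)\<close>, so
  equality forces \<open>A - K\<close> to be empty. Working over the integers keeps the difference
  from truncating when \<open>A\<close> is larger than \<open>K\<close>.\<close>

lemma card_sym_diff_eq_iff_subset:
  assumes "finite A" "finite K"
  shows "int (card ((A - K) \<union> (K - A))) = int (card K) - int (card A) \<longleftrightarrow> A \<subseteq> K"
proof -
  have "card ((A - K) \<union> (K - A)) = card (A - K) + card (K - A)"
    using assms by (intro card_Un_disjoint) auto
  moreover have "card A = card (A \<inter> K) + card (A - K)"
    using assms(1) by (rule card_Int_Diff)
  moreover have "card K = card (A \<inter> K) + card (K - A)"
    using card_Int_Diff[OF assms(2), of A] by (simp add: Int_commute)
  ultimately have "int (card ((A - K) \<union> (K - A))) = int (card K) - int (card A)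
      \<longleftrightarrow> card (A - K) = 0"
    by linarith
  also have "\<dots> \<longleftrightarrow> A \<subseteq> K"
    using assms by auto
  finally show ?thesis .
qed

lemma mem_subcube_iff:
  assumes "p < k" "xk \<in> layer k"
  shows "x \<in> subcube p k xk \<longleftrightarrow> x \<le> xk \<and> p < ones x"
proof -
  have k: "card (Collect xk) = k"
    using assms(2) by (simp add: layer_def ones_def)
  have "hamming x xk = card ((Collect x - Collect xk) \<union> (Collect xk - Collect x))"
    unfolding hamming_def by (rule arg_cong[where f = card]) auto
  then have "int (hamming x xk) = int k - int (ones x) \<longleftrightarrow> Collect x \<subseteq> Collect xk"
    using card_sym_diff_eq_iff_subset[of "Collect x" "Collect xk"] by (simp add: k ones_def)
  moreover have "Collect x \<subseteq> Collect xk \<longleftrightarrow> x \<le> xk"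
    by (auto simp: le_fun_def)
  \<comment> \<open>The witness \<open>i\<close> must be the Hamming distance. Since
    \<open>p < k\<close>, the bound \<open>i \<le> k - p - 1\<close> says that \<open>k - i\<close>,
    the number of ones of \<open>x\<close>, exceeds \<open>p\<close>.\<close>
  moreover have "x \<in> subcube p k xk \<longleftrightarrow>
      int (hamming x xk) = int k - int (ones x) \<and> p < ones x"
    using assms(1) by (auto simp: subcube_def layer_def)
  ultimately show ?thesis by simp
qed

lemma sum_Pow_insert:
  fixes g :: "'a set \<Rightarrow> 'b::comm_monoid_add"
  assumes "finite T" "i \<notin> T"
  shows "(\<Sum>A\<in>Pow (insert i T). g A) = (\<Sum>A\<in>Pow T. g A + g (insert i A))"
proof -
  have inj: "inj_on (insert i) (Pow T)"
    using assms(2) by (intro inj_onI) (metis PowD insert_ident subsetD)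
  have "(\<Sum>A\<in>Pow (insert i T). g A) = sum g (Pow T) + sum g (insert i ` Pow T)"
    unfolding Pow_insert using assms by (intro sum.union_disjoint) auto
  then show ?thesis
    by (simp add: sum.reindex[OF inj] sum.distrib)
qed

lemma sum_of_bool_Pow:
  assumes "finite T"
  shows "(\<Sum>A\<in>Pow T. of_bool (P A)) = real (card {A. A \<subseteq> T \<and> P A})"
proof -
  have "Pow T \<inter> Collect P = {A. A \<subseteq> T \<and> P A}"
    by auto
  then show ?thesis
    using assms by simp
qed

text \<open>For \<open>A\<close> avoiding \<open>i\<close>, the sets \<open>A\<close> and
  \<open>insert i A\<close> carry opposite signs and cancel unless only \<open>A\<close> meets the
  bound, that is, unless \<open>card A = p\<close>. What survives is one \<open>+1\<close> for each
  \<open>p\<close>-subset of \<open>S - {i}\<close>.\<close>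

lemma sum_sign_subsets_card_le:
  assumes "finite S" "i \<in> S"
  shows "(\<Sum>A\<in>Pow S. of_bool (card A \<le> p) * (-1) ^ of_bool (i \<in> A))
      = real ((card S - 1) choose p)"
proof -
  define T where "T = S - {i}"
  have S: "S = insert i T" and T: "finite T" "i \<notin> T"
    using assms by (auto simp: T_def)
  let ?g = "\<lambda>A. of_bool (card A \<le> p) * (-1) ^ of_bool (i \<in> A) :: real"
  have "sum ?g (Pow S) = (\<Sum>A\<in>Pow T. ?g A + ?g (insert i A))"
    unfolding S using T by (rule sum_Pow_insert)
  also have "\<dots> = (\<Sum>A\<in>Pow T. of_bool (card A = p))"
  proof (rule sum.cong)
    fix A assume "A \<in> Pow T"
    then have "i \<notin> A" "finite A"
      using T finite_subset by auto
    then show "?g A + ?g (insert i A) = of_bool (card A = p)"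
      by auto
  qed simp
  also have "\<dots> = real (card {A. A \<subseteq> T \<and> card A = p})"
    using T(1) by (rule sum_of_bool_Pow)
  also have "\<dots> = real ((card S - 1) choose p)"
    using T S by (simp add: n_subsets)
  finally show ?thesis .
qed

text \<open>With \<open>p = card S\<close> the size bound is vacuous, and the binomial coefficient
  vanishes because \<open>S\<close> is nonempty.\<close>

lemma sum_sign_subsets:
  assumes "finite S" "i \<in> S"
  shows "(\<Sum>A\<in>Pow S. (-1) ^ of_bool (i \<in> A)) = (0::real)"
proof -
  have "(\<Sum>A\<in>Pow S. (-1) ^ of_bool (i \<in> A))
      = (\<Sum>A\<in>Pow S. of_bool (card A \<le> card S) * (-1) ^ of_bool (i \<in> A) :: real)"
    using assms(1) by (intro sum.cong) (auto simp: card_mono)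
  also have "\<dots> = real ((card S - 1) choose card S)"
    using assms by (rule sum_sign_subsets_card_le)
  also have "\<dots> = 0"
    using assms card_gt_0_iff[of S] by (auto simp: binomial_eq_0)
  finally show ?thesis .
qed

text \<open>The large subsets complement the small ones, and the signs over all of
  \<open>Pow S\<close> sum to 0, so the two partial sums are opposite.\<close>

lemma sum_sign_subsets_card_gt:
  assumes "finite S" "i \<in> S"
  shows "(\<Sum>A\<in>Pow S. of_bool (p < card A) * (-1) ^ of_bool (i \<in> A))
      = - real ((card S - 1) choose p)"
proof -
  have "(\<Sum>A\<in>Pow S. of_bool (p < card A) * (-1) ^ of_bool (i \<in> A))
      = (\<Sum>A\<in>Pow S. (-1) ^ of_bool (i \<in> A)
           - of_bool (card A \<le> p) * (-1) ^ of_bool (i \<in> A) :: real)"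
    by (intro sum.cong) auto
  then show ?thesis
    using sum_sign_subsets[OF assms] sum_sign_subsets_card_le[OF assms, of p]
    by (simp add: sum_subtractf)
qed

lemma card_subsets_card_gt:
  assumes "finite S"
  shows "card {A. A \<subseteq> S \<and> p < card A} = (\<Sum>l = p + 1..card S. card S choose l)"
proof -
  have "{A. A \<subseteq> S \<and> p < card A} = (\<Union>l\<in>{p + 1..card S}. {A. A \<subseteq> S \<and> card A = l})"
    using assms by (auto simp: card_mono)
  also have "card \<dots> = (\<Sum>l = p + 1..card S. card {A. A \<subseteq> S \<and> card A = l})"
    using assms by (intro card_UN_disjoint) auto
  also have "\<dots> = (\<Sum>l = p + 1..card S. card S choose l)"
    using assms by (simp add: n_subsets)
  finally show ?thesis .
qed

lemma sum_cube_eq_sum_Pow: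
  "(\<Sum>x\<in>UNIV. g (x :: ('n::finite) cube)) = (\<Sum>A\<in>Pow UNIV. g (\<lambda>i. i \<in> A))"
  by (rule sum.reindex_bij_witness[of _ "\<lambda>A i. i \<in> A" Collect]) auto

lemma influence_eq_sum_zeros:
  fixes f :: "('n::finite) cube \<Rightarrow> bool"
  shows "2 ^ CARD('n) * influence f i
      = (\<Sum>A\<in>Pow UNIV. of_bool (\<not> f (\<lambda>i. i \<in> A)) * (-1) ^ of_bool (i \<in> A))"
proof -
  have "2 ^ CARD('n) * influence f i
      = (\<Sum>A\<in>Pow UNIV. of_bool (f (\<lambda>i. i \<in> A)) * (-1) ^ (1 + of_bool (i \<in> A)))"
    unfolding influence_def by (subst sum_cube_eq_sum_Pow) simp
  \<comment> \<open>The extra 1 in the exponent negates the sign, and minus the indicator of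
    \<open>f\<close> is the indicator of its zeros minus 1.\<close>
  also have "\<dots> = (\<Sum>A\<in>Pow UNIV. of_bool (\<not> f (\<lambda>i. i \<in> A)) * (-1) ^ of_bool (i \<in> A)
        - (-1) ^ of_bool (i \<in> A))"
    by (intro sum.cong) auto
  finally show ?thesis
    using sum_sign_subsets[of UNIV i] by (simp add: sum_subtractf)
qed

text \<open>The small zeros of \<open>f\<close> range over the whole cube and give the first
  binomial coefficient. The sum over the large zeros stays unevaluated, since only its value depends
  on whether \<open>i\<close> is an inlier or an outlier.\<close>

lemma influence_ideal:
  fixes f :: "('n::finite) cube \<Rightarrow> bool"
  assumes "p < k" "xk \<in> layer k" "ideal_wrt p k xk f"
  shows "2 ^ CARD('n) * influence f i = real ((CARD('n) - 1) choose p)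
      + (\<Sum>A\<in>Pow (Collect xk). of_bool (p < card A) * (-1) ^ of_bool (i \<in> A))"
proof -
  let ?s = "\<lambda>A. (-1) ^ of_bool (i \<in> A) :: real"
  have zero: "\<not> f (\<lambda>i. i \<in> A) \<longleftrightarrow> card A \<le> p \<or> A \<subseteq> Collect xk \<and> p < card A" for A
  proof -
    have "\<not> f (\<lambda>i. i \<in> A) \<longleftrightarrow> (\<lambda>i. i \<in> A) \<in> subcube p k xk \<union> layers_upto p"
      using assms(3) unfolding ideal_wrt_def by blast
    then show ?thesis
      using mem_subcube_iff[OF assms(1,2), of "\<lambda>i. i \<in> A"]
      by (auto simp: layers_upto_def ones_def le_fun_def subset_iff)
  qed
  \<comment> \<open>The two kinds of zeros exclude each other by size, so their indicators
    add.\<close>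
  have "2 ^ CARD('n) * influence f i = (\<Sum>A\<in>Pow UNIV. of_bool (card A \<le> p) * ?s A
      + (if A \<in> Pow (Collect xk) then of_bool (p < card A) * ?s A else 0))"
    unfolding influence_eq_sum_zeros zero by (intro sum.cong) auto
  also have "\<dots> = (\<Sum>A\<in>Pow UNIV. of_bool (card A \<le> p) * ?s A)
      + (\<Sum>A\<in>Pow UNIV. if A \<in> Pow (Collect xk) then of_bool (p < card A) * ?s A else 0)"
    by (rule sum.distrib)
  also have "(\<Sum>A\<in>Pow UNIV. if A \<in> Pow (Collect xk) then of_bool (p < card A) * ?s A else 0)
      = (\<Sum>A\<in>Pow (Collect xk). of_bool (p < card A) * ?s A)"
    by (subst sum.inter_restrict[symmetric]) simp_all
  finally show ?thesis
    using sum_sign_subsets_card_le[of UNIV i p] by simp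
qed

theorem theorem1:
  fixes f :: "('n::finite) cube \<Rightarrow> bool" and xk :: "'n cube" and p k :: nat
  assumes "p < k" and "k \<le> CARD('n)"
    and "xk \<in> layer k"
    and "mono f"
    and "ideal_wrt p k xk f"
  shows "(\<forall>i. xk i \<longrightarrow>
            2 ^ CARD('n) * influence f i
              = real ((CARD('n) - 1) choose p) - real ((k - 1) choose p)) \<and>
         (\<forall>j. \<not> xk j \<longrightarrow>
            2 ^ CARD('n) * influence f j
              = real ((CARD('n) - 1) choose p) + (\<Sum>l = p + 1..k. real (k choose l)))"
proof (intro conjI allI impI)
  have k: "card (Collect xk) = k"
    using assms(3) by (simp add: layer_def ones_def)
  note influence = influence_ideal[OF assms(1,3,5)]
  show "2 ^ CARD('n) * influence f i
      = real ((CARD('n) - 1) choose p) - real ((k - 1) choose p)" if "xk i" for i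
    \<comment> \<open>An inlier lies in \<open>Collect xk\<close>, so the pairing can be carried out
      among the subsets of that set.\<close>
    using that sum_sign_subsets_card_gt[of "Collect xk" i p] by (simp add: influence k)
  show "2 ^ CARD('n) * influence f j
      = real ((CARD('n) - 1) choose p) + (\<Sum>l = p + 1..k. real (k choose l))"
    if "\<not> xk j" for j
  proof -
    \<comment> \<open>An outlier belongs to no subset of \<open>Collect xk\<close>: every sign is
      \<open>+1\<close>, nothing cancels, and the sum merely counts.\<close>
    have "(\<Sum>A\<in>Pow (Collect xk). of_bool (p < card A) * (-1) ^ of_bool (j \<in> A))
        = (\<Sum>A\<in>Pow (Collect xk). of_bool (p < card A) :: real)"
      using that by (intro sum.cong) auto
    also have "\<dots> = real (card {A. A \<subseteq> Collect xk \<and> p < card A})"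
      by (rule sum_of_bool_Pow) simp
    also have "\<dots> = (\<Sum>l = p + 1..k. real (k choose l))"
      using card_subsets_card_gt[of "Collect xk" p] by (simp add: k)
    finally show ?thesis
      by (simp add: influence)
  qed
qed

end
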